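(* Let $K$ be a field, $S_1,\dots,S_n\subseteq \mathrm{S}_{\mathrm{val}}(K)$, $t\in K^\times$, and $x_1,\dots,x_n\in K$ with $x_i\in\mathcal{O}_v$ for each $v\in S_i$ and each $i$. Assume: (U) the uniformity assumption (defined in the context) holds for $S=S_1\cup\dots\cup S_n$ and $t$; (T) each $S_i$ is compact in $\mathcal{T}_{\mathrm{Zar}^*}$; (I) the $S_i$ are pairwise $t$-independent and pairwise incomparable. Then there exists $x\in K$ with $x\in\mathcal{O}_v$ for each $v\in S_i$ for every $i$ such that $$\overline{x}=\overline{x_i}\ \text{ in the residue field } Kv\quad\text{for all } v\in S_i,\ \text{for } i=1,\dots,n.$$
   Context: $\mathrm{S}_{\mathrm{val}}(K)$ is the set of equivalence classes of Krull valuations on $K$ (written additively, trivial one included). $\mathcal{O}_v=\{x\in K: v(x)\ge0\}$, $\mathfrak{m}_v=\{x\in K: v(x)>0\}$, $\mathcal{O}_v^\times=\mathcal{O}_v\setminus\mathfrak{m}_v$, $Kv=\mathcal{O}_v/\mathfrak{m}_v$. The topology $\mathcal{T}_{\mathrm{Zar}^*}$ on $\mathrm{S}_{\mathrm{val}}(K)$ has open subbasis $\{v: v(x)>0\}$, $x\in K$; compact means quasi-compact. If $\mathcal{O}_v\subseteq\mathcal{O}_w$, then $v$ is a refinement of $w$ and $w$ a coarsening of $v$ (equality allowed); incomparable means neither refines the other; $v\vee w$ is the finest common coarsening of $v$ and $w$. Valuations $v,w$ are $t$-independent if $t\in\mathcal{O}_{v\vee w}^\times$. Two sets of valuations are incomparable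 (resp. $t$-independent) if every element of the first is incomparable (resp. $t$-independent) to every element of the second. Uniformity assumption for $S$ and $t\in K^\times$: there exists $f\in K[X]$ of degree $d\ge2$ with leading coefficient $a_d$ such that for all $v\in S$: (i) for any $x\in\mathcal{O}_v$, $f(x)\in\mathcal{O}_v$; (ii) for any $x\in\mathcal{O}_v$, $f(x)\notin t\mathfrak{m}_v$; (iii) for any $x\in K\setminus\mathcal{O}_v$, $f(x)\in x^d(\mathcal{O}_v\setminus t\mathfrak{m}_v)\cap(a_dx^d+x^{d-1}\mathcal{O}_v)$; (iv) $\mathcal{O}_v+\mathcal{O}_v\subseteq t^{-1}\mathcal{O}_v$. *)

theory Defs
  imports
    "HOL-Analysis.Abstract_Topology"
    "HOL-Computational_Algebra.Polynomial"
    "HOL-Library.Set_Algebras"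
    "HOL-Algebra.QuotRing"
begin

section \<open>Krull valuations\<close>

text \<open>
  HOL-Algebra writes abstract abelian groups multiplicatively: below, \<open>\<otimes>\<close> and \<open>\<one>\<close> are the
  addition and the zero of the value group.
\<close>

locale ordered_abelian_group = comm_group G for G (structure) +
  fixes r :: "'g rel"
  assumes linear: "linear_order_on (carrier G) r"
    and translate: "(a, b) \<in> r \<Longrightarrow> c \<in> carrier G \<Longrightarrow> (a \<otimes> c, b \<otimes> c) \<in> r"

text \<open>A value is an element of \<open>'g option\<close>, where \<^const>\<open>None\<close> stands for \<open>\<infinity>\<close>.\<close>

record ('k, 'g) valuation =
  vgroup :: "'g monoid"
  vless_eq :: "'g rel"
  val :: "'k \<Rightarrow> 'g option"

fun ext_le :: "'g rel \<Rightarrow> 'g option \<Rightarrow> 'g option \<Rightarrow> bool" where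
  "ext_le r a None = True"
| "ext_le r None (Some b) = False"
| "ext_le r (Some a) (Some b) = ((a, b) \<in> r)"

fun ext_add :: "'g monoid \<Rightarrow> 'g option \<Rightarrow> 'g option \<Rightarrow> 'g option" where
  "ext_add G (Some a) (Some b) = Some (a \<otimes>\<^bsub>G\<^esub> b)"
| "ext_add G a b = None"

text \<open>
  The last clause says \<open>v (x + y) \<ge> min (v x) (v y)\<close>. The value group may be larger than the image
  of \<open>v\<close>, which does not affect the equivalence classes.
\<close>

definition krull_valuation :: "('k::field, 'g) valuation \<Rightarrow> bool" where
  "krull_valuation v \<longleftrightarrow>
     ordered_abelian_group (vgroup v) (vless_eq v) \<and>
     (\<forall>x. val v x \<in> insert None (Some ` carrier (vgroup v))) \<and>
     (\<forall>x. val v x = None \<longleftrightarrow> x = 0) \<and>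
     (\<forall>x y. val v (x * y) = ext_add (vgroup v) (val v x) (val v y)) \<and>
     (\<forall>x y. ext_le (vless_eq v) (val v x) (val v (x + y)) \<or>
            ext_le (vless_eq v) (val v y) (val v (x + y)))"

definition vring :: "('k, 'g) valuation \<Rightarrow> 'k set" where
  "vring v = {x. ext_le (vless_eq v) (Some \<one>\<^bsub>vgroup v\<^esub>) (val v x)}"

definition vmax :: "('k, 'g) valuation \<Rightarrow> 'k set" where
  "vmax v = {x. ext_le (vless_eq v) (Some \<one>\<^bsub>vgroup v\<^esub>) (val v x) \<and>
                val v x \<noteq> Some \<one>\<^bsub>vgroup v\<^esub>}"

text \<open>
  Equality of valuation rings is the usual notion of equivalence; it amounts to an order
  isomorphism between the images of the two valuations that commutes with them.
\<close>

definition valuation_equiv :: "('k::field, 'g) valuation \<Rightarrow> ('k, 'g) valuation \<Rightarrow> bool" where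
  "valuation_equiv v w \<longleftrightarrow> krull_valuation v \<and> krull_valuation w \<and> vring v = vring w"


section \<open>Valuation rings\<close>

definition valuation_subring :: "'k::field set \<Rightarrow> bool" where
  "valuation_subring A \<longleftrightarrow>
     1 \<in> A \<and> (\<forall>x\<in>A. \<forall>y\<in>A. x + y \<in> A) \<and> (\<forall>x\<in>A. \<forall>y\<in>A. x * y \<in> A) \<and> (\<forall>x\<in>A. - x \<in> A) \<and>
     (\<forall>x. x \<in> A \<or> inverse x \<in> A)"

lemma krull_valuation_vring:
  fixes v :: "('k::field, 'g) valuation"
  assumes "krull_valuation v"
  shows "valuation_subring (vring v)"
    and "vmax v = {x. x = 0 \<or> inverse x \<notin> vring v}"
proof -
  define G where "G = vgroup v"
  define r where "r = vless_eq v"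
  interpret ordered_abelian_group G r
    using assms by (simp add: krull_valuation_def G_def r_def)
  define g where "g x = the (val v x)" for x
  have v0: "val v x = None \<longleftrightarrow> x = 0" for x
    using assms by (simp add: krull_valuation_def)
  have vg: "val v x = Some (g x)" if "x \<noteq> 0" for x
    using v0[of x] that by (auto simp: g_def)
  have gc [simp]: "g x \<in> carrier G" if "x \<noteq> 0" for x
  proof -
    have "val v x \<in> insert None (Some ` carrier G)"
      using assms unfolding krull_valuation_def G_def by blast
    then show ?thesis using vg[OF that] by auto
  qed
  have gm: "g (x * y) = g x \<otimes>\<^bsub>G\<^esub> g y" if "x \<noteq> 0" "y \<noteq> 0" for x y
  proof -
    have "val v (x * y) = ext_add G (val v x) (val v y)"
      using assms by (simp add: krull_valuation_def G_def)
    then show ?thesis using vg that by simp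
  qed
  have ga: "(g x, g (x + y)) \<in> r \<or> (g y, g (x + y)) \<in> r"
    if "x \<noteq> 0" "y \<noteq> 0" "x + y \<noteq> 0" for x y
  proof -
    have "ext_le r (val v x) (val v (x + y)) \<or> ext_le r (val v y) (val v (x + y))"
      using assms by (simp add: krull_valuation_def r_def)
    then show ?thesis using vg that by simp
  qed
  have tr: "(a, b) \<in> r \<Longrightarrow> (b, c) \<in> r \<Longrightarrow> (a, c) \<in> r" for a b c
    using linear unfolding linear_order_on_def partial_order_on_def preorder_on_def
    by (meson transD)
  have asym: "(a, b) \<in> r \<Longrightarrow> (b, a) \<in> r \<Longrightarrow> a = b" for a b
    using linear unfolding linear_order_on_def partial_order_on_def by (meson antisymD)
  have rfl: "a \<in> carrier G \<Longrightarrow> (a, a) \<in> r" for a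
    using linear unfolding linear_order_on_def partial_order_on_def preorder_on_def
    by (meson refl_onD)
  have tot: "a \<in> carrier G \<Longrightarrow> b \<in> carrier G \<Longrightarrow> (a, b) \<in> r \<or> (b, a) \<in> r" for a b
    using linear rfl unfolding linear_order_on_def total_on_def by metis
  have g1: "g 1 = \<one>\<^bsub>G\<^esub>"
  proof -
    have "g 1 \<otimes>\<^bsub>G\<^esub> g 1 = g 1" using gm[of 1 1] by simp
    then show ?thesis by (metis gc one_neq_zero r_cancel_one')
  qed
  have gn1: "g (- 1) = \<one>\<^bsub>G\<^esub>"
  proof -
    define a where "a = g (- 1)"
    have ac: "a \<in> carrier G" by (simp add: a_def)
    have aa: "a \<otimes>\<^bsub>G\<^esub> a = \<one>\<^bsub>G\<^esub>" using gm[of "-1" "-1"] g1 by (simp add: a_def)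
    consider "(\<one>\<^bsub>G\<^esub>, a) \<in> r" | "(a, \<one>\<^bsub>G\<^esub>) \<in> r" using tot[OF ac one_closed] by auto
    then have "a = \<one>\<^bsub>G\<^esub>"
    proof cases
      case 1
      then show ?thesis using translate[OF 1 ac] aa ac asym by auto
    next
      case 2
      then show ?thesis using translate[OF 2 ac] aa ac asym by auto
    qed
    then show ?thesis by (simp add: a_def)
  qed
  have mem: "x \<in> vring v \<longleftrightarrow> x = 0 \<or> (\<one>\<^bsub>G\<^esub>, g x) \<in> r" for x
    using vg[of x] v0[of x] by (cases "x = 0") (auto simp: vring_def G_def r_def)
  have memx: "x \<in> vmax v \<longleftrightarrow> x = 0 \<or> (\<one>\<^bsub>G\<^esub>, g x) \<in> r \<and> g x \<noteq> \<one>\<^bsub>G\<^esub>" for x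
    using vg[of x] v0[of x] by (cases "x = 0") (auto simp: vmax_def G_def r_def)
  have gi: "g x \<otimes>\<^bsub>G\<^esub> g (inverse x) = \<one>\<^bsub>G\<^esub>" if "x \<noteq> 0" for x
    using gm[of x "inverse x"] that g1 by simp
  have inv1: "(g (inverse x), \<one>\<^bsub>G\<^esub>) \<in> r" if "x \<noteq> 0" "(\<one>\<^bsub>G\<^esub>, g x) \<in> r" for x
    using translate[OF that(2), of "g (inverse x)"] that gi[of x] by simp
  have inv2: "(\<one>\<^bsub>G\<^esub>, g (inverse x)) \<in> r" if "x \<noteq> 0" "(g x, \<one>\<^bsub>G\<^esub>) \<in> r" for x
    using translate[OF that(2), of "g (inverse x)"] that gi[of x] by simp
  have mul: "x * y \<in> vring v" if "x \<in> vring v" "y \<in> vring v" for x y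
  proof (cases "x = 0 \<or> y = 0")
    case False
    then have "(\<one>\<^bsub>G\<^esub> \<otimes>\<^bsub>G\<^esub> g y, g x \<otimes>\<^bsub>G\<^esub> g y) \<in> r"
      using False that by (intro translate) (auto simp: mem)
    then have "(g y, g (x * y)) \<in> r" using False gm by simp
    moreover have "(\<one>\<^bsub>G\<^esub>, g y) \<in> r" using False that by (simp add: mem)
    ultimately have "(\<one>\<^bsub>G\<^esub>, g (x * y)) \<in> r" using tr by blast
    then show ?thesis by (simp add: mem)
  qed (auto simp: mem)
  have add: "x + y \<in> vring v" if "x \<in> vring v" "y \<in> vring v" for x y
  proof (cases "x = 0 \<or> y = 0 \<or> x + y = 0")
    case False
    then have "(\<one>\<^bsub>G\<^esub>, g x) \<in> r" "(\<one>\<^bsub>G\<^esub>, g y) \<in> r" using that by (simp_all add: mem)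
    then have "(\<one>\<^bsub>G\<^esub>, g (x + y)) \<in> r" using ga[of x y] False tr by blast
    then show ?thesis by (simp add: mem)
  qed (use that in \<open>auto simp: mem\<close>)
  have neg: "- x \<in> vring v" if "x \<in> vring v" for x
    using mul[OF _ that, of "- 1"] rfl[OF one_closed] gn1 by (simp add: mem)
  have inverse: "x \<in> vring v \<or> inverse x \<in> vring v" for x
    using tot[OF one_closed, of "g x"] inv2[of x] by (auto simp: mem)
  show "valuation_subring (vring v)"
    unfolding valuation_subring_def using mul add neg inverse rfl[OF one_closed] g1
    by (auto simp: mem)
  have "x \<in> vmax v \<longleftrightarrow> x = 0 \<or> inverse x \<notin> vring v" for x
  proof (cases "x = 0")
    case False
    have "(\<one>\<^bsub>G\<^esub>, g x) \<in> r \<and> g x \<noteq> \<one>\<^bsub>G\<^esub> \<longleftrightarrow> (\<one>\<^bsub>G\<^esub>, g (inverse x)) \<notin> r"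
    proof
      assume a: "(\<one>\<^bsub>G\<^esub>, g x) \<in> r \<and> g x \<noteq> \<one>\<^bsub>G\<^esub>"
      show "(\<one>\<^bsub>G\<^esub>, g (inverse x)) \<notin> r"
        using inv1[of "inverse x"] a asym False by auto
    next
      assume a: "(\<one>\<^bsub>G\<^esub>, g (inverse x)) \<notin> r"
      have "(\<one>\<^bsub>G\<^esub>, g x) \<in> r" using tot[OF one_closed, of "g x"] inv2[of x] a False by auto
      moreover have "g x \<noteq> \<one>\<^bsub>G\<^esub>" using gi[of x] a False rfl[OF one_closed] by auto
      ultimately show "(\<one>\<^bsub>G\<^esub>, g x) \<in> r \<and> g x \<noteq> \<one>\<^bsub>G\<^esub>" by simp
    qed
    then show ?thesis using False by (simp add: mem memx)
  qed (simp add: memx)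
  then show "vmax v = {x. x = 0 \<or> inverse x \<notin> vring v}" by auto
qed

text \<open>
  Every valuation ring of a field \<open>K\<close> is the ring of a valuation whose value group
  \<open>K\<^sup>\<times>/\<O>\<^sup>\<times>\<close> is realised on a system of representatives inside \<open>K\<close>.
\<close>

lemma valuation_subring_vring:
  fixes A :: "'k::field set"
  assumes "valuation_subring A"
  shows "\<exists>v :: ('k, 'k) valuation. krull_valuation v \<and> vring v = A"
proof -
  have one: "1 \<in> A" and add: "\<And>x y. x \<in> A \<Longrightarrow> y \<in> A \<Longrightarrow> x + y \<in> A"
    and mul: "\<And>x y. x \<in> A \<Longrightarrow> y \<in> A \<Longrightarrow> x * y \<in> A"
    and tot: "\<And>x. x \<in> A \<or> inverse x \<in> A"
    using assms by (auto simp: valuation_subring_def)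
  have zero: "0 \<in> A" using tot[of 0] by simp
  define e where "e x y \<longleftrightarrow> x \<noteq> 0 \<and> y \<noteq> 0 \<and> x / y \<in> A \<and> y / x \<in> A" for x y
  have er: "e x x" if "x \<noteq> 0" for x using that one by (simp add: e_def)
  have es: "e x y \<Longrightarrow> e y x" for x y by (auto simp: e_def)
  have qt: "x / z \<in> A" if "x / y \<in> A" "y / z \<in> A" "y \<noteq> 0" for x y z
    using mul[OF that(1,2)] that(3) by (simp add: field_simps)
  have et: "e x y \<Longrightarrow> e y z \<Longrightarrow> e x z" for x y z
    unfolding e_def using qt by blast
  have em: "e (x * y) (x' * y')" if "e x x'" "e y y'" for x y x' y'
    using that mul[of "x / x'" "y / y'"] mul[of "x' / x" "y' / y"] by (simp add: e_def)
  define h where "h x = (SOME y. e x y)" for x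
  have eh: "e x (h x)" if "x \<noteq> 0" for x
    unfolding h_def using er[OF that] by (rule someI)
  have heq: "h x = h y \<longleftrightarrow> e x y" if "x \<noteq> 0" "y \<noteq> 0" for x y
  proof
    assume "h x = h y"
    then have "e x (h y)" using eh[OF that(1)] by simp
    then show "e x y" using es[OF eh[OF that(2)]] by (rule et)
  next
    assume "e x y"
    then have "e x z \<longleftrightarrow> e y z" for z using es[of x y] et[of x y z] et[of y x z] by auto
    then have "e x = e y" by auto
    then show "h x = h y" by (simp add: h_def)
  qed
  have h0: "h x \<noteq> 0" if "x \<noteq> 0" for x using eh[OF that] by (simp add: e_def)
  have hh: "h (h x) = h x" if "x \<noteq> 0" for x
    using heq[OF h0[OF that] that] eh[OF that] es by blast
  define C where "C = h ` {x. x \<noteq> 0}"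
  have C: "x \<in> C \<longleftrightarrow> x \<noteq> 0 \<and> h x = x" for x
  proof
    assume "x \<in> C"
    then obtain y where "y \<noteq> 0" "x = h y" by (auto simp: C_def)
    then show "x \<noteq> 0 \<and> h x = x" using hh[of y] h0[of y] by simp
  next
    assume "x \<noteq> 0 \<and> h x = x"
    then show "x \<in> C" unfolding C_def by (intro image_eqI[of x h x]) auto
  qed
  have hC: "h x \<in> C" if "x \<noteq> 0" for x using that by (auto simp: C_def)
  define G where "G = \<lparr>carrier = C, mult = (\<lambda>x y. h (x * y)), one = h 1\<rparr>"
  have hm: "h (h x * y) = h (x * y)" if "x \<noteq> 0" "y \<noteq> 0" for x y
    using that heq[of "h x * y" "x * y"] h0[OF that(1)] em[OF es[OF eh[OF that(1)]] er[OF that(2)]]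
    by simp
  have hm': "h (y * h x) = h (y * x)" if "x \<noteq> 0" "y \<noteq> 0" for x y
    using hm[OF that] by (simp add: mult.commute)
  define r where "r = {(x, y). x \<in> C \<and> y \<in> C \<and> y / x \<in> A}"
  have rh: "(h x, h y) \<in> r \<longleftrightarrow> y / x \<in> A" if "x \<noteq> 0" "y \<noteq> 0" for x y
  proof -
    have ex: "h x \<noteq> 0" "x / h x \<in> A" "h x / x \<in> A"
      and ey: "h y \<noteq> 0" "y / h y \<in> A" "h y / y \<in> A"
      using eh[OF that(1)] eh[OF that(2)] by (auto simp: e_def)
    have "h y / h x \<in> A \<longleftrightarrow> y / x \<in> A"
    proof
      assume "h y / h x \<in> A"
      then show "y / x \<in> A" using qt[OF qt[OF ey(2) _ ey(1)] ex(3) ex(1)] by simp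
    next
      assume "y / x \<in> A"
      then show "h y / h x \<in> A" using qt[OF qt[OF ey(3) _ that(2)] ex(2) that(1)] by simp
    qed
    then show ?thesis using that hC by (simp add: r_def)
  qed
  have G: "comm_group G"
  proof (rule comm_groupI)
    show "x \<otimes>\<^bsub>G\<^esub> y \<in> carrier G" if "x \<in> carrier G" "y \<in> carrier G" for x y
      using that hC[of "x * y"] by (simp add: G_def C)
    show "\<one>\<^bsub>G\<^esub> \<in> carrier G" using hC[of 1] by (simp add: G_def)
    show "(x \<otimes>\<^bsub>G\<^esub> y) \<otimes>\<^bsub>G\<^esub> z = x \<otimes>\<^bsub>G\<^esub> (y \<otimes>\<^bsub>G\<^esub> z)"
      if "x \<in> carrier G" "y \<in> carrier G" "z \<in> carrier G" for x y z
      using that hm[of "x * y" z] hm'[of "y * z" x] by (simp add: G_def C mult.assoc)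
    show "x \<otimes>\<^bsub>G\<^esub> y = y \<otimes>\<^bsub>G\<^esub> x" for x y by (simp add: G_def mult.commute)
    show "\<one>\<^bsub>G\<^esub> \<otimes>\<^bsub>G\<^esub> x = x" if "x \<in> carrier G" for x
      using that hm[of 1 x] by (simp add: G_def C)
    show "\<exists>y\<in>carrier G. y \<otimes>\<^bsub>G\<^esub> x = \<one>\<^bsub>G\<^esub>" if "x \<in> carrier G" for x
      using that hm[of "inverse x" x] hC[of "inverse x"]
      by (intro bexI[of _ "h (inverse x)"]) (auto simp: G_def C)
  qed
  have inv_quot: "x / y \<in> A \<or> y / x \<in> A" for x y
    using tot[of "x / y"] by simp
  have lin: "linear_order_on C r"
    unfolding linear_order_on_def partial_order_on_def preorder_on_def
  proof (intro conjI)
    show "r \<subseteq> C \<times> C" by (auto simp: r_def)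
    show "refl_on C r" using one by (auto simp: r_def refl_on_def C)
    show "trans r"
    proof (rule transI)
      fix x y z assume "(x, y) \<in> r" "(y, z) \<in> r"
      then show "(x, z) \<in> r" using qt[of z y x] by (auto simp: r_def C)
    qed
    show "antisym r"
    proof (rule antisymI)
      fix x y assume "(x, y) \<in> r" "(y, x) \<in> r"
      then show "x = y" using heq[of x y] by (auto simp: r_def C e_def)
    qed
    show "total_on C r" using inv_quot by (auto simp: r_def total_on_def)
  qed
  have tra: "(a \<otimes>\<^bsub>G\<^esub> c, b \<otimes>\<^bsub>G\<^esub> c) \<in> r" if "(a, b) \<in> r" "c \<in> carrier G" for a b c
    using that rh[of "a * c" "b * c"] by (auto simp: r_def G_def C)
  interpret comm_group G by (rule G)
  have oag: "ordered_abelian_group G r"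
    by unfold_locales (use lin tra in \<open>auto simp: G_def\<close>)
  define f where "f x = (if x = 0 then None else Some (h x))" for x
  define v where "v = \<lparr>vgroup = G, vless_eq = r, val = f\<rparr>"
  have ult: "ext_le r (f x) (f (x + y)) \<or> ext_le r (f y) (f (x + y))" for x y
  proof (cases "x = 0 \<or> y = 0 \<or> x + y = 0")
    case True
    then show ?thesis using rh[of x x] rh[of y y] one by (auto simp: f_def)
  next
    case False
    then have "(x + y) / x = 1 + y / x" "(x + y) / y = 1 + x / y" by (auto simp: field_simps)
    then have "(x + y) / x \<in> A \<or> (x + y) / y \<in> A" using inv_quot[of x y] add one by auto
    then show ?thesis using False rh by (auto simp: f_def)
  qed
  have "krull_valuation v"
    unfolding krull_valuation_def using oag ult
    by (auto simp: v_def f_def G_def hC hm hm' h0)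
  moreover have "vring v = A"
    using rh[of 1] zero by (auto simp: vring_def v_def f_def G_def)
  ultimately show ?thesis by blast
qed


section \<open>The space of valuations\<close>

text \<open>
  The type \<open>'k sval\<close> is the set of equivalence classes of Krull valuations on the field \<open>'k\<close>.
  Taking the value groups inside \<open>'k\<close> loses nothing: by \<open>ex_sval\<close> below, a valuation with values
  in any type \<open>'g\<close> has the same valuation ring as some member of \<open>'k sval\<close>.
\<close>

quotient_type (overloaded) 'k sval = "('k::field, 'k) valuation" / partial: valuation_equiv
proof (rule part_equivpI)
  have "valuation_subring (UNIV :: 'k set)" by (simp add: valuation_subring_def)
  from valuation_subring_vring[OF this]
  show "\<exists>x :: ('k, 'k) valuation. valuation_equiv x x" by (auto simp: valuation_equiv_def)
  show "symp (valuation_equiv :: ('k, 'k) valuation \<Rightarrow> _)"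
    by (auto simp: symp_def valuation_equiv_def)
  show "transp (valuation_equiv :: ('k, 'k) valuation \<Rightarrow> _)"
    by (auto simp: transp_def valuation_equiv_def)
qed

lift_definition val_ring :: "'k::field sval \<Rightarrow> 'k set" is vring
  by (simp add: valuation_equiv_def)

lift_definition val_ideal :: "'k::field sval \<Rightarrow> 'k set" is vmax
  by (simp add: valuation_equiv_def krull_valuation_vring(2))

definition val_units :: "'k::field sval \<Rightarrow> 'k set" where
  "val_units v = val_ring v - val_ideal v"

lemma ex_sval:
  fixes v :: "('k::field, 'g) valuation"
  assumes "krull_valuation v"
  shows "\<exists>u :: 'k sval. val_ring u = vring v \<and> val_ideal u = vmax v"
proof -
  obtain w :: "('k, 'k) valuation" where w: "krull_valuation w" "vring w = vring v"
    using valuation_subring_vring[OF krull_valuation_vring(1)[OF assms]] by blast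
  have e: "valuation_equiv w w" using w by (simp add: valuation_equiv_def)
  have "val_ring (abs_sval w) = vring w" "val_ideal (abs_sval w) = vmax w"
    using e by (simp_all add: val_ring.abs_eq val_ideal.abs_eq)
  moreover have "vmax w = vmax v" using w assms by (simp add: krull_valuation_vring(2))
  ultimately show ?thesis using w by metis
qed

lemma valuation_subring_val_ring: "valuation_subring (val_ring v)"
  by transfer (simp add: valuation_equiv_def krull_valuation_vring(1))

lemma val_ring_inject: "val_ring v = val_ring w \<longleftrightarrow> v = w"
  by transfer (simp add: valuation_equiv_def)

definition ring_of_val :: "'k::field sval \<Rightarrow> 'k ring" where
  "ring_of_val v = \<lparr>carrier = val_ring v, mult = (*), one = 1, zero = 0, add = (+)\<rparr>"

definition residue_field :: "'k::field sval \<Rightarrow> 'k set ring" where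
  "residue_field v = ring_of_val v Quot val_ideal v"

text \<open>The class of \<open>x\<close> in \<open>residue_field v\<close>; meaningful for \<open>x \<in> val_ring v\<close>.\<close>

definition residue :: "'k::field sval \<Rightarrow> 'k \<Rightarrow> 'k set" where
  "residue v x = val_ideal v +>\<^bsub>ring_of_val v\<^esub> x"

definition Zar_star :: "'k::field sval topology" where
  "Zar_star = topology_generated_by {{v. x \<in> val_ideal v} |x. True}"

lemma residue_in_residue_field:
  "x \<in> val_ring v \<Longrightarrow> residue v x \<in> carrier (residue_field v)"
  by (auto simp: residue_def residue_field_def FactRing_def A_RCOSETS_def' ring_of_val_def)

lemma topspace_Zar_star: "topspace Zar_star = (UNIV :: 'k::field sval set)"
proof -
  have "(0::'k::field) \<in> val_ideal v" for v
    by transfer (simp add: valuation_equiv_def krull_valuation_vring(2))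
  then have "(UNIV :: 'k sval set) = {v. 0 \<in> val_ideal v}" by auto
  then have "(UNIV :: 'k sval set) \<in> {{v. x \<in> val_ideal v} |x. True}" by blast
  then show ?thesis unfolding Zar_star_def by auto
qed


section \<open>Coarsenings and independence\<close>

definition refines :: "'k::field sval \<Rightarrow> 'k sval \<Rightarrow> bool" where
  "refines v w \<longleftrightarrow> val_ring v \<subseteq> val_ring w"

definition incomparable :: "'k::field sval \<Rightarrow> 'k sval \<Rightarrow> bool" where
  "incomparable v w \<longleftrightarrow> \<not> refines v w \<and> \<not> refines w v"

definition is_finest_coarsening :: "'k::field sval \<Rightarrow> 'k sval \<Rightarrow> 'k sval \<Rightarrow> bool" where
  "is_finest_coarsening v w u \<longleftrightarrow> refines v u \<and> refines w u \<and>
     (\<forall>u'. refines v u' \<and> refines w u' \<longrightarrow> refines u u')"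

definition vjoin :: "'k::field sval \<Rightarrow> 'k sval \<Rightarrow> 'k sval" where
  "vjoin v w = (THE u. is_finest_coarsening v w u)"

lemma vjoin: "is_finest_coarsening v w (vjoin v w)"
proof -
  define B where "B = \<Inter> {val_ring u' |u'. refines v u' \<and> refines w u'}"
  have vB: "val_ring v \<subseteq> B" and wB: "val_ring w \<subseteq> B" by (auto simp: B_def refines_def)
  have sub: "valuation_subring (val_ring u)" for u :: "'a sval" by (rule valuation_subring_val_ring)
  have "valuation_subring B"
    unfolding valuation_subring_def
  proof (intro conjI)
    show "1 \<in> B" using sub[of v] vB by (auto simp: valuation_subring_def)
    show "\<forall>x. x \<in> B \<or> inverse x \<in> B" using sub[of v] vB by (auto simp: valuation_subring_def)
    have mem: "x \<in> B \<longleftrightarrow> (\<forall>u. refines v u \<and> refines w u \<longrightarrow> x \<in> val_ring u)" for x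
      by (auto simp: B_def)
    have "x \<in> val_ring u \<Longrightarrow> y \<in> val_ring u \<Longrightarrow> x + y \<in> val_ring u"
      "x \<in> val_ring u \<Longrightarrow> y \<in> val_ring u \<Longrightarrow> x * y \<in> val_ring u"
      "x \<in> val_ring u \<Longrightarrow> - x \<in> val_ring u" for x y and u :: "'a sval"
      using sub[of u] by (simp_all add: valuation_subring_def)
    then show "\<forall>x\<in>B. \<forall>y\<in>B. x + y \<in> B" "\<forall>x\<in>B. \<forall>y\<in>B. x * y \<in> B" "\<forall>x\<in>B. - x \<in> B"
      by (simp_all add: mem)
  qed
  then obtain k :: "('a, 'a) valuation" where k: "krull_valuation k" "vring k = B"
    using valuation_subring_vring by blast
  then obtain u :: "'a sval" where u: "val_ring u = B" using ex_sval[OF k(1)] by auto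
  have "is_finest_coarsening v w u"
    using vB wB by (auto simp: is_finest_coarsening_def refines_def u B_def)
  moreover have "u' = u" if "is_finest_coarsening v w u'" for u'
    using that calculation
    by (metis is_finest_coarsening_def refines_def subset_antisym val_ring_inject)
  ultimately show ?thesis unfolding vjoin_def by (rule theI)
qed

definition t_independent :: "'k::field \<Rightarrow> 'k sval \<Rightarrow> 'k sval \<Rightarrow> bool" where
  "t_independent t v w \<longleftrightarrow> t \<in> val_units (vjoin v w)"

definition sets_incomparable :: "'k::field sval set \<Rightarrow> 'k sval set \<Rightarrow> bool" where
  "sets_incomparable S T \<longleftrightarrow> (\<forall>v\<in>S. \<forall>w\<in>T. incomparable v w)"

definition sets_t_independent :: "'k::field \<Rightarrow> 'k sval set \<Rightarrow> 'k sval set \<Rightarrow> bool" where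
  "sets_t_independent t S T \<longleftrightarrow> (\<forall>v\<in>S. \<forall>w\<in>T. t_independent t v w)"


section \<open>The uniformity assumption\<close>

definition uniformity_assumption :: "'k::field sval set \<Rightarrow> 'k \<Rightarrow> bool" where
  "uniformity_assumption S t \<longleftrightarrow>
     (\<exists>f :: 'k poly. degree f \<ge> 2 \<and>
       (\<forall>v\<in>S.
          (\<forall>x\<in>val_ring v. poly f x \<in> val_ring v) \<and>
          (\<forall>x\<in>val_ring v. poly f x \<notin> t *o val_ideal v) \<and>
          (\<forall>x. x \<notin> val_ring v \<longrightarrow>
             poly f x \<in> ((x ^ degree f) *o (val_ring v - t *o val_ideal v)) \<inter>
               ((lead_coeff f * x ^ degree f) +o ((x ^ (degree f - 1)) *o val_ring v))) \<and>
          val_ring v + val_ring v \<subseteq> inverse t *o val_ring v))"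

end

theory Submission
  imports Defs
begin

text \<open>
  It suffices to find, for each \<open>i\<close>, an element \<open>e\<close> that is \<open>1\<close> in the residue fields on \<open>S i\<close> and
  such that \<open>e\<close> and \<open>e a\<^sub>i\<close> are infinitesimal on every other \<open>S j\<close>; then \<open>x = \<Sum> e\<^sub>i a\<^sub>i\<close>. With \<open>f\<close> the
  polynomial of degree \<open>d\<close> from the uniformity assumption, \<open>e = a\<^sub>d y\<^sup>d / f y\<close> works as soon as
  \<open>v y < - v t\<close> on \<open>S i\<close> and \<open>v y, v (y a\<^sub>i) > v t\<close> on the other sets. For a single pair \<open>v\<close>, \<open>w\<close>
  such a \<open>y\<close> exists because the ring of \<open>v \<or> w\<close> is the set of products \<open>\<O>\<^sub>v \<O>\<^sub>w\<close>. These
  solutions are glued by compactness: \<open>y\<^sup>d f (x / y)\<close> has value \<open>d min (v x) (v y)\<close> up to an error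
  between \<open>0\<close> and \<open>v t\<close>, uniformly in \<open>v\<close>, so it simulates a minimum and, after inverting \<open>x\<close> and
  \<open>y\<close>, a maximum.
\<close>

section \<open>Arithmetic of a valuation ring\<close>

text \<open>This expresses the ideal through the ring alone, so that value groups can be left
  behind.\<close>

lemma val_ideal_eq: "val_ideal v = {x. x = 0 \<or> inverse x \<notin> val_ring v}"
  by transfer (simp add: valuation_equiv_def krull_valuation_vring(2))

context
  fixes v :: "'k::field sval"
begin

lemma val_ring_one [simp]: "1 \<in> val_ring v"
  and val_ring_add: "x \<in> val_ring v \<Longrightarrow> y \<in> val_ring v \<Longrightarrow> x + y \<in> val_ring v"
  and val_ring_mult: "x \<in> val_ring v \<Longrightarrow> y \<in> val_ring v \<Longrightarrow> x * y \<in> val_ring v"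
  and val_ring_uminus: "x \<in> val_ring v \<Longrightarrow> - x \<in> val_ring v"
  and val_ring_or_inverse: "x \<in> val_ring v \<or> inverse x \<in> val_ring v"
  using valuation_subring_val_ring[of v] by (auto simp: valuation_subring_def)

lemma val_ring_zero [simp]: "0 \<in> val_ring v"
  using val_ring_or_inverse[of 0] by simp

lemma val_ring_diff: "x \<in> val_ring v \<Longrightarrow> y \<in> val_ring v \<Longrightarrow> x - y \<in> val_ring v"
  using val_ring_add[of x "- y"] val_ring_uminus[of y] by simp

lemma val_ring_power: "x \<in> val_ring v \<Longrightarrow> x ^ n \<in> val_ring v"
  by (induction n) (auto intro: val_ring_mult)

lemma val_ideal_zero [simp]: "0 \<in> val_ideal v"
  by (simp add: val_ideal_eq)

lemma val_ideal_imp_val_ring: "x \<in> val_ideal v \<Longrightarrow> x \<in> val_ring v"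
  using val_ring_or_inverse[of x] by (auto simp: val_ideal_eq)

lemma inverse_in_val_ideal: "x \<notin> val_ring v \<Longrightarrow> inverse x \<in> val_ideal v"
  by (simp add: val_ideal_eq)

lemma inverse_in_val_ring: "x \<notin> val_ideal v \<Longrightarrow> inverse x \<in> val_ring v"
  by (simp add: val_ideal_eq)

lemma val_ideal_mult:
  assumes "x \<in> val_ideal v" "y \<in> val_ring v"
  shows "x * y \<in> val_ideal v"
proof (cases "x = 0 \<or> y = 0")
  case False
  have "inverse (x * y) \<notin> val_ring v"
  proof
    assume "inverse (x * y) \<in> val_ring v"
    then have "y * inverse (x * y) \<in> val_ring v" using assms(2) by (intro val_ring_mult)
    then show False using assms(1) False by (simp add: val_ideal_eq field_simps)
  qed
  then show ?thesis by (simp add: val_ideal_eq)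
qed auto

lemma val_ideal_mult': "x \<in> val_ring v \<Longrightarrow> y \<in> val_ideal v \<Longrightarrow> x * y \<in> val_ideal v"
  using val_ideal_mult[of y x] by (simp add: mult.commute)

text \<open>One of \<open>y / x\<close> and \<open>x / y\<close> lies in the ring, so the sum is
  \<open>x\<close> or \<open>y\<close> times a ring element.\<close>

lemma val_ideal_add:
  assumes "x \<in> val_ideal v" "y \<in> val_ideal v"
  shows "x + y \<in> val_ideal v"
proof (cases "x = 0 \<or> y = 0")
  case False
  have "x + y = x * (1 + y / x)" "x + y = y * (1 + x / y)" using False by (simp_all add: field_simps)
  moreover have "y / x \<in> val_ring v \<or> x / y \<in> val_ring v"
    using val_ring_or_inverse[of "y / x"] by simp
  ultimately show ?thesis using assms val_ideal_mult val_ring_add val_ring_one by metis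
qed (use assms in auto)

lemma val_ideal_uminus: "x \<in> val_ideal v \<Longrightarrow> - x \<in> val_ideal v"
  using val_ideal_mult'[of "- 1" x] val_ring_uminus[of 1] by simp

lemma val_ideal_sum: "(\<And>i. i \<in> I \<Longrightarrow> g i \<in> val_ideal v) \<Longrightarrow> sum g I \<in> val_ideal v"
  by (induction I rule: infinite_finite_induct) (auto intro: val_ideal_add)

lemma residue_eqI:
  assumes "x - y \<in> val_ideal v"
  shows "residue v x = residue v y"
proof -
  have res: "residue v z = {h + z |h. h \<in> val_ideal v}" for z
    by (auto simp: residue_def a_r_coset_def r_coset_def ring_of_val_def)
  have "residue v x' \<subseteq> residue v y'" if "x' - y' \<in> val_ideal v" for x' y'
  proof
    fix z assume "z \<in> residue v x'"
    then obtain h where "h \<in> val_ideal v" "z = h + x'" by (auto simp: res)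
    then have "h + (x' - y') \<in> val_ideal v" "z = (h + (x' - y')) + y'"
      using that val_ideal_add by auto
    then show "z \<in> residue v y'" unfolding res by blast
  qed
  moreover have "y - x \<in> val_ideal v" using val_ideal_uminus[OF assms] by simp
  ultimately show ?thesis using assms by blast
qed

end


section \<open>Pairs of valuations\<close>

text \<open>The products \<open>p * q\<close> form a valuation ring containing both rings, hence
  contain the ring of the finest common coarsening. Closure under sums comes from factoring out
  \<open>x\<close> or \<open>y\<close>, according to which of \<open>y / x\<close> and
  \<open>x / y\<close> lies in \<open>val_ring v\<close>.\<close>

lemma val_ring_vjoinE:
  fixes v w :: "'k::field sval"
  assumes "c \<in> val_ring (vjoin v w)"
  obtains p q where "p \<in> val_ring v" "q \<in> val_ring w" "c = p * q"
proof -
  define B where "B = {p * q |p q. p \<in> val_ring v \<and> q \<in> val_ring w}"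
  have vB: "x \<in> B" if "x \<in> val_ring v" for x
    unfolding B_def using that val_ring_one[of w]
    by (metis (mono_tags, lifting) mem_Collect_eq mult.right_neutral)
  have wB: "x \<in> B" if "x \<in> val_ring w" for x
    unfolding B_def using that val_ring_one[of v] by (metis (mono_tags, lifting) mem_Collect_eq mult_1)
  have mult: "x * y \<in> B" if "x \<in> B" "y \<in> B" for x y
  proof -
    obtain p q p' q' where "x = p * q" "y = p' * q'" "p \<in> val_ring v" "q \<in> val_ring w"
      "p' \<in> val_ring v" "q' \<in> val_ring w" using \<open>x \<in> B\<close> \<open>y \<in> B\<close> by (auto simp: B_def)
    then have "x * y = (p * p') * (q * q')" "p * p' \<in> val_ring v" "q * q' \<in> val_ring w"
      by (auto intro: val_ring_mult)
    then show ?thesis unfolding B_def by blast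
  qed
  have add: "x + y \<in> B" if "x \<in> B" "y \<in> B" for x y
  proof (cases "x = 0 \<or> y = 0")
    case False
    have "x + y = x * (1 + y / x)" "x + y = y * (1 + x / y)"
      using False by (simp_all add: field_simps)
    moreover have "y / x \<in> val_ring v \<or> x / y \<in> val_ring v"
      using val_ring_or_inverse[of "y / x"] by simp
    ultimately show ?thesis using that mult vB val_ring_add val_ring_one by metis
  qed (use that in auto)
  have neg: "- x \<in> B" if "x \<in> B" for x
    using mult[OF vB[OF val_ring_uminus[OF val_ring_one]] that] by simp
  have "valuation_subring B"
    unfolding valuation_subring_def
  proof (intro conjI ballI allI)
    show "x \<in> B \<or> inverse x \<in> B" for x
      using val_ring_or_inverse[of x v] vB by blast
  qed (use add mult neg vB[OF val_ring_one] in auto)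
  then obtain u :: "'k sval" where u: "val_ring u = B"
    using valuation_subring_vring[of B] ex_sval by blast
  then have "refines (vjoin v w) u"
    using vjoin[of v w] vB wB unfolding is_finest_coarsening_def refines_def by blast
  then have "c \<in> B" using assms u by (auto simp: refines_def)
  then show thesis using that by (auto simp: B_def)
qed

text \<open>Incomparability yields an element separating \<open>v\<close> from \<open>w\<close>.
  Independence puts \<open>inverse t\<close> into the ring of the join, so it factors through the
  two rings, and the factors serve to strengthen the separation by \<open>t\<close>.\<close>

lemma ex_pair_separating:
  fixes v w :: "'k::field sval"
  assumes "incomparable v w" "t_independent t v w" "t \<noteq> 0"
    and t: "t \<in> val_ring v" "t \<in> val_ring w" and a: "a \<in> val_ring v"
  shows "\<exists>y. y \<noteq> 0 \<and> inverse y / t \<in> val_ideal v \<and> y / t \<in> val_ideal w \<and> y * a / t \<in> val_ideal w"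
proof -
  have "val_ring v \<subseteq> val_ring (vjoin v w)"
    using vjoin[of v w] by (simp add: is_finest_coarsening_def refines_def)
  then have aj: "a \<in> val_ring (vjoin v w)" using a by blast
  have tj: "inverse t \<in> val_ring (vjoin v w)"
    using assms(2) by (auto simp: t_independent_def val_units_def intro: inverse_in_val_ring)
  obtain r s where rs: "r \<in> val_ring v" "r \<notin> val_ring w" "s \<in> val_ring w" "s \<notin> val_ring v"
    using assms(1) by (auto simp: incomparable_def refines_def)
  then have rs0: "r \<noteq> 0" "s \<noteq> 0" by auto
  \<comment> \<open>\<open>z\<close> has negative value at \<open>v\<close> and positive value at
    \<open>w\<close>, but perhaps too close to zero compared with \<open>t\<close>.\<close>
  define z where "z = s / r"
  have z: "z \<noteq> 0" "inverse z \<in> val_ideal v" "z \<in> val_ideal w"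
    using val_ideal_mult'[OF rs(1) inverse_in_val_ideal[OF rs(4)]]
      val_ideal_mult'[OF rs(3) inverse_in_val_ideal[OF rs(2)]] rs0
    by (simp_all add: z_def field_simps)
  obtain p q where pq: "p \<in> val_ring v" "q \<in> val_ring w" "inverse t = p * q"
    using val_ring_vjoinE[OF tj] by metis
  then have pq0: "p \<noteq> 0" "q \<noteq> 0" using \<open>t \<noteq> 0\<close> by auto
  have ptq: "p * t = inverse q" "q * t = inverse p" using pq(3) pq0 \<open>t \<noteq> 0\<close> by (simp_all add: field_simps)
  have iq: "inverse q \<in> val_ring v" "inverse p \<in> val_ring w"
    using val_ring_mult[OF pq(1) t(1)] val_ring_mult[OF pq(2) t(2)] by (simp_all add: ptq)
  \<comment> \<open>This factor absorbs \<open>a\<close>. If \<open>a\<close> is not in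
    \<open>val_ring w\<close>, take \<open>y = inverse p'\<close> where \<open>a = p' * q'\<close>:
    then \<open>y * a = q'\<close>, and \<open>y = q' * inverse a\<close> is integral at
    \<open>w\<close> because \<open>a\<close> has negative value there.\<close>
  obtain y where y: "y \<noteq> 0" "inverse y \<in> val_ring v" "y \<in> val_ring w" "y * a \<in> val_ring w"
  proof (cases "a \<in> val_ring w")
    case True
    then show thesis using that[of 1] by simp
  next
    case False
    obtain p' q' where p': "p' \<in> val_ring v" "q' \<in> val_ring w" "a = p' * q'"
      using val_ring_vjoinE[OF aj] by metis
    then have 0: "p' \<noteq> 0" "q' \<noteq> 0" using False by auto
    have "q' * inverse a \<in> val_ring w"
      using p'(2) val_ring_or_inverse[of a w] False by (intro val_ring_mult) auto
    then show thesis using that[of "inverse p'"] p' 0 by (simp add: field_simps)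
  qed
  \<comment> \<open>Since \<open>inverse t = p * q\<close>, the factor \<open>q / p\<close> turns
    division by \<open>t\<close> into multiplication by \<open>p * p\<close> at \<open>v\<close> and
    by \<open>q * q\<close> at \<open>w\<close>, both integral.\<close>
  define x where "x = z * (q / p) * y"
  have "inverse x / t = inverse z * (p * p * inverse y)"
    using pq0 z(1) y(1) \<open>t \<noteq> 0\<close> pq(3) by (simp add: x_def field_simps)
  moreover have "\<dots> \<in> val_ideal v"
    by (intro val_ideal_mult val_ring_mult z pq y)
  moreover have "x / t = z * (q * q * y)" "x * a / t = z * (q * q * (y * a))"
    using pq0 by (simp_all add: x_def divide_inverse[of _ t] pq(3))
  moreover have "z * (q * q * y) \<in> val_ideal w" "z * (q * q * (y * a)) \<in> val_ideal w"
    by (intro val_ideal_mult val_ring_mult z pq y)+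
  moreover have "x \<noteq> 0" using z(1) pq0 y(1) by (simp add: x_def)
  ultimately show ?thesis by metis
qed


section \<open>Gluing\<close>

text \<open>A finite subcover is merged one member at a time. Directedness is asked only inside
  \<open>C\<close>, because a glued element is controlled only at the valuations of the given
  compact set.\<close>

lemma compactin_directed:
  assumes "compactin X C" "Y \<noteq> {}"
    and "\<And>y. y \<in> Y \<Longrightarrow> openin X (U y)"
    and "\<And>c. c \<in> C \<Longrightarrow> \<exists>y\<in>Y. c \<in> U y"
    and dir: "\<And>x y. x \<in> Y \<Longrightarrow> y \<in> Y \<Longrightarrow> \<exists>z\<in>Y. C \<inter> (U x \<union> U y) \<subseteq> U z"
  shows "\<exists>y\<in>Y. C \<subseteq> U y"
proof -
  obtain \<F> where F: "finite \<F>" "\<F> \<subseteq> U ` Y" "C \<subseteq> \<Union>\<F>"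
  proof -
    have "C \<subseteq> \<Union>(U ` Y)" using assms(4) by auto
    then show thesis using compactinD[OF assms(1), of "U ` Y"] assms(3) that by blast
  qed
  then obtain Z where Z: "Z \<subseteq> Y" "finite Z" "\<F> = U ` Z"
    using finite_subset_image[OF F(1,2)] by blast
  have "\<exists>y\<in>Y. C \<inter> \<Union>(U ` Z) \<subseteq> U y"
    using Z(2,1)
  proof (induction Z)
    case empty
    then show ?case using assms(2) by auto
  next
    case (insert x Z)
    then obtain y where "y \<in> Y" "C \<inter> \<Union>(U ` Z) \<subseteq> U y" by auto
    moreover obtain z where "z \<in> Y" "C \<inter> (U x \<union> U y) \<subseteq> U z"
      using dir[of x y] \<open>y \<in> Y\<close> insert.prems by auto
    ultimately have "C \<inter> \<Union>(U ` insert x Z) \<subseteq> U z" by auto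
    with \<open>z \<in> Y\<close> show ?case by blast
  qed
  then show ?thesis using F(3) Z(3) by auto
qed

lemma openin_Zar_star: "openin Zar_star {v. x \<in> val_ideal v}"
  unfolding Zar_star_def by (rule topology_generated_by_Basis) auto

section \<open>Minima simulated uniformly by a polynomial\<close>

locale uniform_family =
  fixes S :: "'k::field sval set" and t :: 'k and f :: "'k poly"
  assumes t0: "t \<noteq> 0"
    and deg: "degree f \<ge> 2"
    and poly_in: "\<And>v x. v \<in> S \<Longrightarrow> x \<in> val_ring v \<Longrightarrow> poly f x \<in> val_ring v"
    and poly_notin: "\<And>v x. v \<in> S \<Longrightarrow> x \<in> val_ring v \<Longrightarrow> poly f x \<notin> t *o val_ideal v"
    and poly_out: "\<And>v x. v \<in> S \<Longrightarrow> x \<notin> val_ring v \<Longrightarrow>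
       poly f x \<in> (x ^ degree f) *o (val_ring v - t *o val_ideal v)"
    and poly_lead: "\<And>v x. v \<in> S \<Longrightarrow> x \<notin> val_ring v \<Longrightarrow>
       poly f x \<in> (lead_coeff f * x ^ degree f) +o ((x ^ (degree f - 1)) *o val_ring v)"
    and sums: "\<And>v. v \<in> S \<Longrightarrow> val_ring v + val_ring v \<subseteq> inverse t *o val_ring v"
begin

abbreviation d :: nat where "d \<equiv> degree f"

text \<open>As \<open>val_ring v\<close> is closed under sums, condition (iv) says exactly this; the
  sum \<open>1 + 0\<close> suffices to extract it.\<close>

lemma t_in:
  assumes "v \<in> S"
  shows "t \<in> val_ring v"
proof -
  have "(1::'k) + 0 \<in> val_ring v + val_ring v" by (intro set_plus_intro) auto
  then have "(1::'k) \<in> inverse t *o val_ring v" using sums[OF assms] by auto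
  then obtain y where "y \<in> val_ring v" "1 = inverse t * y" by (auto simp: elt_set_times_def)
  then show ?thesis using t0 by (simp add: field_simps)
qed

text \<open>Avoiding \<open>t *o val_ideal v\<close> means that the value of \<open>u\<close> is at
  most that of \<open>t\<close>; the quotient form is the one that multiplies well.\<close>

lemma div_in_val_ring:
  assumes "u \<notin> t *o val_ideal v"
  shows "u \<noteq> 0" "t / u \<in> val_ring v"
proof -
  have *: "u / t \<notin> val_ideal v"
    using assms t0 by (auto simp: elt_set_times_def)
  then show "u \<noteq> 0" by auto
  show "t / u \<in> val_ring v" using inverse_in_val_ring[OF *] by simp
qed

lemma poly_outE:
  assumes "v \<in> S" "x \<notin> val_ring v"
  obtains u where "u \<in> val_ring v" "u \<noteq> 0" "t / u \<in> val_ring v" "poly f x = x ^ d * u"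
proof -
  obtain u where "u \<in> val_ring v" "u \<notin> t *o val_ideal v" "poly f x = x ^ d * u"
    using poly_out[OF assms] unfolding elt_set_times_def by blast
  then show thesis using that div_in_val_ring by blast
qed

text \<open>For nontrivial \<open>v\<close>, both halves of (iii) describe \<open>poly f x\<close>
  at some \<open>x\<close> outside the ring. Dividing by \<open>x ^ d\<close> gives
  \<open>lead_coeff f = u - inverse x * r\<close>, where \<open>inverse x\<close> is
  integral.\<close>

lemma lead_coeff_in:
  assumes "v \<in> S"
  shows "lead_coeff f \<in> val_ring v"
proof (cases "val_ring v = UNIV")
  case False
  then obtain x where x: "x \<notin> val_ring v" by auto
  then have x0: "x \<noteq> 0" by auto
  obtain u where u: "u \<in> val_ring v" "poly f x = x ^ d * u" using poly_outE[OF assms x] by metis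
  obtain r where r: "r \<in> val_ring v" "poly f x = lead_coeff f * x ^ d + x ^ (d - 1) * r"
    using poly_lead[OF assms x] by (auto simp: elt_set_times_def elt_set_plus_def)
  have "x ^ d = x ^ (d - 1) * x" using deg by (metis One_nat_def Suc_le_D Suc_1 diff_Suc_1 power_Suc2)
  then have "x ^ (d - 1) * (x * u) = x ^ (d - 1) * (lead_coeff f * x + r)"
    using u(2) r(2) by (simp add: algebra_simps)
  then have "x * u = lead_coeff f * x + r" using x0 by simp
  then have "lead_coeff f = u - inverse x * r" using x0 by (simp add: field_simps)
  moreover have "inverse x \<in> val_ring v" using val_ring_or_inverse[of x v] x by blast
  ultimately show ?thesis using u(1) r(1) by (metis val_ring_diff val_ring_mult)
qed simp

text \<open>For nonzero \<open>y\<close>, this is the degree \<open>d\<close> homogenization of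
  \<open>f\<close>.\<close>

definition glue :: "'k \<Rightarrow> 'k \<Rightarrow> 'k" where
  "glue x y = y ^ d * poly f (x / y)"

text \<open>Whichever of \<open>x\<close> and \<open>y\<close> has the smaller value,
  \<open>glue x y\<close> is its \<open>d\<close>-th power times some \<open>u\<close> of value
  between 0 and that of \<open>t\<close>. An upper bound by the minimum is an upper bound by each,
  so the last two facts need no case distinction.\<close>

lemma glue:
  assumes "v \<in> S" "x \<noteq> 0" "y \<noteq> 0"
  shows "glue x y \<noteq> 0"
    and "glue x y / x ^ d \<in> val_ring v \<or> glue x y / y ^ d \<in> val_ring v"
    and "t * x ^ d / glue x y \<in> val_ring v" "t * y ^ d / glue x y \<in> val_ring v"
proof -
  have "glue x y \<noteq> 0 \<and> (glue x y / x ^ d \<in> val_ring v \<or> glue x y / y ^ d \<in> val_ring v) \<and>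
    t * x ^ d / glue x y \<in> val_ring v \<and> t * y ^ d / glue x y \<in> val_ring v"
  proof (cases "x / y \<in> val_ring v")
    case True
    define u where "u = poly f (x / y)"
    have u: "u \<in> val_ring v" "u \<noteq> 0" "t / u \<in> val_ring v"
      using poly_in[OF assms(1) True] div_in_val_ring[OF poly_notin[OF assms(1) True]]
      by (simp_all add: u_def)
    have "glue x y = y ^ d * u" by (simp add: glue_def u_def)
    moreover have "(x / y) ^ d * (t / u) \<in> val_ring v"
      using True u by (intro val_ring_mult val_ring_power)
    ultimately show ?thesis using u assms by (simp add: power_divide mult.commute)
  next
    case False
    obtain u where u: "u \<in> val_ring v" "u \<noteq> 0" "t / u \<in> val_ring v" "poly f (x / y) = (x / y) ^ d * u"
      using poly_outE[OF assms(1) False] .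
    have "inverse (x / y) \<in> val_ring v" using val_ring_or_inverse[of "x / y" v] False by blast
    then have "(y / x) ^ d * (t / u) \<in> val_ring v"
      using u by (intro val_ring_mult val_ring_power) simp_all
    moreover have "glue x y = x ^ d * u" using assms by (simp add: glue_def u power_divide)
    ultimately show ?thesis using u assms by (simp add: power_divide mult.commute)
  qed
  then show "glue x y \<noteq> 0"
    and "glue x y / x ^ d \<in> val_ring v \<or> glue x y / y ^ d \<in> val_ring v"
    and "t * x ^ d / glue x y \<in> val_ring v" "t * y ^ d / glue x y \<in> val_ring v"
    by auto
qed

lemma power_d: "x ^ d = x * x * x ^ (d - 2)" for x :: 'k
  using deg by (metis le_add_diff_inverse power2_eq_square power_add)

text \<open>With \<open>z\<close> the one of \<open>x\<close>, \<open>y\<close> that bounds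
  \<open>glue x y\<close> from below, one factor \<open>z\<close> takes care of \<open>b / t\<close>
  and the others are integral. The parameter \<open>b\<close> covers both \<open>1\<close> and
  \<open>a\<close>.\<close>

lemma glue_small:
  assumes "v \<in> S" "x \<noteq> 0" "y \<noteq> 0" "b \<in> val_ring v \<or> b = a"
    and "x / t \<in> val_ideal v" "x * a / t \<in> val_ideal v"
    and "y / t \<in> val_ideal v" "y * a / t \<in> val_ideal v"
  shows "glue x y * b / t \<in> val_ideal v"
proof -
  have *: "glue x y * b / t \<in> val_ideal v"
    if z: "z \<noteq> 0" "z / t \<in> val_ideal v" "z * a / t \<in> val_ideal v" "glue x y / z ^ d \<in> val_ring v" for z
  proof -
    have "z / t * t \<in> val_ideal v" using z(2) t_in[OF assms(1)] by (rule val_ideal_mult)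
    then have zr: "z \<in> val_ring v" using t0 by (simp add: val_ideal_imp_val_ring)
    have "z * b / t \<in> val_ideal v"
      using assms(4) z(3) val_ideal_mult[OF z(2), of b] by (auto simp: field_simps)
    then have "z * b / t * (z * z ^ (d - 2) * (glue x y / z ^ d)) \<in> val_ideal v"
      using zr z(4) by (intro val_ideal_mult val_ring_mult val_ring_power)
    then show ?thesis using z(1) by (simp add: power_d field_simps)
  qed
  show ?thesis using glue(2)[OF assms(1-3)] *[of x] *[of y] assms by blast
qed

text \<open>Inverting \<open>g\<close> costs a factor \<open>t\<close>. Two factors
  \<open>inverse z\<close> are split off: one pays this cost, the other provides the bound on
  \<open>b / t\<close>. Here \<open>degree f \<ge> 2\<close> enters.\<close>

lemma glue_large:
  assumes "v \<in> S" "z \<noteq> 0" "t * z ^ d / g \<in> val_ring v"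
    and "inverse z / t \<in> val_ideal v" "inverse z * b / t \<in> val_ideal v"
  shows "inverse g * b / t \<in> val_ideal v"
proof -
  have "inverse z / t * t \<in> val_ideal v" using assms(4) t_in[OF assms(1)] by (rule val_ideal_mult)
  then have "inverse z \<in> val_ring v" using t0 by (simp add: val_ideal_imp_val_ring)
  then have "(inverse z * b / t) * ((inverse z / t) * inverse z ^ (d - 2) * (t * z ^ d / g)) \<in> val_ideal v"
    using assms by (intro val_ideal_mult val_ring_mult val_ring_power val_ideal_imp_val_ring[of "inverse z / t"])
  then show ?thesis using assms(2) t0 by (simp add: power_d field_simps)
qed

section \<open>Separating two compact sets\<close>

lemma ex_large_small:
  assumes A: "A \<subseteq> S" "A \<noteq> {}" "compactin Zar_star A"
    and B: "B \<subseteq> S" "B \<noteq> {}" "compactin Zar_star B"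
    and pair: "\<And>v w. v \<in> A \<Longrightarrow> w \<in> B \<Longrightarrow> \<exists>y. y \<noteq> 0 \<and> inverse y / t \<in> val_ideal v \<and>
      y / t \<in> val_ideal w \<and> y * a / t \<in> val_ideal w"
  shows "\<exists>y. y \<noteq> 0 \<and> (\<forall>v\<in>A. inverse y / t \<in> val_ideal v) \<and>
    (\<forall>w\<in>B. y / t \<in> val_ideal w \<and> y * a / t \<in> val_ideal w)"
proof -
  define P where "P y = {v. inverse y / t \<in> val_ideal v}" for y
  define Q where "Q y = {w. y / t \<in> val_ideal w} \<inter> {w. y * a / t \<in> val_ideal w}" for y
  have openP: "openin Zar_star (P y)" for y
    unfolding P_def by (rule openin_Zar_star)
  have openQ: "openin Zar_star (Q y)" for y
    unfolding Q_def by (intro openin_Int openin_Zar_star)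
  \<comment> \<open>First stage: \<open>v\<close> is fixed and compactness of \<open>B\<close> is
    used.\<close>
  have step: "\<exists>y. y \<noteq> 0 \<and> v \<in> P y \<and> B \<subseteq> Q y" if v: "v \<in> A" for v
  proof -
    define Y where "Y = {y. y \<noteq> 0 \<and> v \<in> P y}"
    have vS: "v \<in> S" using v A by auto
    have "\<exists>y\<in>Y. B \<subseteq> Q y"
    proof (rule compactin_directed[OF B(3)])
      show cover: "\<exists>y\<in>Y. w \<in> Q y" if "w \<in> B" for w
        using pair[OF v that] by (auto simp: Y_def P_def Q_def)
      then show "Y \<noteq> {}" using B(2) by blast
      show "\<exists>z\<in>Y. B \<inter> (Q x \<union> Q y) \<subseteq> Q z" if "x \<in> Y" "y \<in> Y" for x y
      proof -
        have xy: "inverse x \<noteq> 0" "inverse y \<noteq> 0" "inverse x / t \<in> val_ideal v" "inverse y / t \<in> val_ideal v"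
          using that by (auto simp: Y_def P_def)
        \<comment> \<open>Up to the error, \<open>inverse g\<close> has \<open>d\<close> times the
          maximum of the values of \<open>x\<close> and \<open>y\<close>. It is therefore small
          wherever one of them is, and still large at \<open>v\<close>, where both are.\<close>
        define g where "g = glue (inverse x) (inverse y)"
        have "g / t \<in> val_ideal v"
          using glue_small[OF vS xy(1,2), of 1 1] xy by (simp add: g_def)
        then have gY: "inverse g \<in> Y" using glue(1)[OF vS xy(1,2)] by (simp add: Y_def P_def g_def)
        have "w \<in> Q (inverse g)" if "w \<in> B" "w \<in> Q z" "z = x \<or> z = y" for w z
        proof -
          have wS: "w \<in> S" using that B by auto
          have z: "z / t \<in> val_ideal w" "z * a / t \<in> val_ideal w" using that by (auto simp: Q_def)
          have g: "t * inverse z ^ d / g \<in> val_ring w"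
            using glue(3,4)[OF wS xy(1,2)] that(3) by (auto simp: g_def)
          have "inverse z \<noteq> 0" using that xy by auto
          then show ?thesis
            using glue_large[OF wS _ g, of 1] glue_large[OF wS _ g, of a] z by (simp add: Q_def)
        qed
        then show ?thesis using gY by blast
      qed
    qed (rule openQ)
    then show ?thesis by (auto simp: Y_def)
  qed
  \<comment> \<open>Second stage: compactness of \<open>A\<close>, with \<open>B\<close> treated as
    a whole. Now a minimum is needed: \<open>glue x y\<close> is large wherever \<open>x\<close> or
    \<open>y\<close> is, and small on \<open>B\<close>, where both are.\<close>
  define Y where "Y = {y. y \<noteq> 0 \<and> B \<subseteq> Q y}"
  have "\<exists>y\<in>Y. A \<subseteq> P y"
  proof (rule compactin_directed[OF A(3)])
    show "\<exists>y\<in>Y. v \<in> P y" if "v \<in> A" for v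
      using step[OF that] by (auto simp: Y_def)
    then show "Y \<noteq> {}" using A(2) by blast
    show "\<exists>z\<in>Y. A \<inter> (P x \<union> P y) \<subseteq> P z" if "x \<in> Y" "y \<in> Y" for x y
    proof -
      have xy: "x \<noteq> 0" "y \<noteq> 0" "B \<subseteq> Q x" "B \<subseteq> Q y" using that by (auto simp: Y_def)
      have "w \<in> Q (glue x y)" if "w \<in> B" for w
      proof -
        have wS: "w \<in> S" using that B by auto
        have q: "x / t \<in> val_ideal w" "x * a / t \<in> val_ideal w" "y / t \<in> val_ideal w" "y * a / t \<in> val_ideal w"
          using xy that by (auto simp: Q_def)
        show ?thesis
          using glue_small[OF wS xy(1,2) _ q, of 1] glue_small[OF wS xy(1,2) _ q, of a]
          by (simp add: Q_def)
      qed
      \<comment> \<open>A valuation in \<open>S\<close> is needed to know that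
        \<open>glue x y\<close> is nonzero.\<close>
      moreover obtain w where "w \<in> B" using B(2) by blast
      ultimately have gY: "glue x y \<in> Y" using glue(1)[OF _ xy(1,2), of w] B(1) by (auto simp: Y_def)
      have "v \<in> P (glue x y)" if "v \<in> A" "v \<in> P z" "z = x \<or> z = y" for v z
      proof -
        have vS: "v \<in> S" using that A by auto
        have g: "t * z ^ d / glue x y \<in> val_ring v"
          using glue(3,4)[OF vS xy(1,2)] that(3) by auto
        have "z \<noteq> 0" using that xy by auto
        then show ?thesis using glue_large[OF vS _ g, of 1] that(2) by (simp add: P_def)
      qed
      then show ?thesis using gY by blast
    qed
  qed (rule openP)
  then show ?thesis by (auto simp: Y_def P_def Q_def subset_iff)
qed

lemma ex_indicator:
  assumes A: "A \<subseteq> S" "compactin Zar_star A"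
    and B: "B \<subseteq> S" "compactin Zar_star B"
    and ind: "sets_t_independent t A B" "sets_incomparable A B"
    and a: "\<And>v. v \<in> A \<Longrightarrow> a \<in> val_ring v"
  shows "\<exists>e. (\<forall>v\<in>A. e - 1 \<in> val_ideal v) \<and> (\<forall>w\<in>B. e * a \<in> val_ideal w)"
\<comment> \<open>The separation result asks for nonempty sets; otherwise a constant works.\<close>
proof (cases "A = {} \<or> B = {}")
  case True
  then show ?thesis
  proof
    assume "A = {}"
    then show ?thesis by (intro exI[of _ 0]) simp
  next
    assume "B = {}"
    then show ?thesis by (intro exI[of _ 1]) simp
  qed
next
  case False
  have pair: "\<exists>y. y \<noteq> 0 \<and> inverse y / t \<in> val_ideal v \<and> y / t \<in> val_ideal w \<and> y * a / t \<in> val_ideal w"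
    if "v \<in> A" "w \<in> B" for v w
  proof (rule ex_pair_separating)
    show "incomparable v w" "t_independent t v w"
      using that ind by (simp_all add: sets_t_independent_def sets_incomparable_def)
    show "t \<in> val_ring v" "t \<in> val_ring w" "a \<in> val_ring v"
      using that A B a t_in by auto
  qed (rule t0)
  obtain y where y: "y \<noteq> 0" "\<And>v. v \<in> A \<Longrightarrow> inverse y / t \<in> val_ideal v"
    "\<And>w. w \<in> B \<Longrightarrow> y / t \<in> val_ideal w" "\<And>w. w \<in> B \<Longrightarrow> y * a / t \<in> val_ideal w"
    using ex_large_small[OF A(1) _ A(2) B(1) _ B(2) pair] False by auto
  define e where "e = lead_coeff f * y ^ d / poly f y"
  have "e - 1 \<in> val_ideal v" if "v \<in> A" for v
  proof -
    have vS: "v \<in> S" using that A by auto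
    have out: "y \<notin> val_ring v"
    proof
      assume yv: "y \<in> val_ring v"
      have "inverse y / t * (y * t) \<in> val_ideal v"
        using yv t_in[OF vS] by (intro val_ideal_mult val_ring_mult y(2) that)
      then show False using y(1) t0 by (simp add: val_ideal_eq)
    qed
    obtain u where u: "u \<noteq> 0" "t / u \<in> val_ring v" "poly f y = y ^ d * u"
      using poly_outE[OF vS out] .
    obtain r where r: "r \<in> val_ring v" "poly f y = lead_coeff f * y ^ d + y ^ (d - 1) * r"
      using poly_lead[OF vS out] by (auto simp: elt_set_times_def elt_set_plus_def)
    have yd: "y ^ d = y ^ (d - 1) * y" using deg by (metis One_nat_def Suc_le_D Suc_1 diff_Suc_1 power_Suc2)
    \<comment> \<open>The leading terms cancel, leaving \<open>- r / (y * u)\<close>; the strict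
      bound on \<open>inverse y / t\<close> outweighs the denominator \<open>u\<close>, as
      \<open>t / u\<close> is integral.\<close>
    have "e - 1 = (lead_coeff f * y ^ d - poly f y) / poly f y"
      using u y(1) by (simp add: e_def diff_divide_distrib)
    also have "\<dots> = - (y ^ (d - 1) * r) / (y ^ (d - 1) * y * u)"
      by (subst u(3)) (simp add: r(2) yd)
    also have "\<dots> = (inverse y / t) * ((t / u) * - r)"
      using u(1) y(1) t0 by (simp add: field_simps)
    finally show ?thesis
      using val_ideal_mult[OF y(2)[OF that] val_ring_mult[OF u(2) val_ring_uminus[OF r(1)]]] by simp
  qed
  moreover have "e * a \<in> val_ideal w" if "w \<in> B" for w
  proof -
    have wS: "w \<in> S" using that B by auto
    have "y / t * t \<in> val_ideal w" using y(3)[OF that] t_in[OF wS] by (rule val_ideal_mult)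
    then have yw: "y \<in> val_ring w" using t0 by (simp add: val_ideal_imp_val_ring)
    note u = div_in_val_ring[OF poly_notin[OF wS yw]]
    \<comment> \<open>One factor \<open>y\<close> makes \<open>a / t\<close> infinitesimal, and this
      \<open>1 / t\<close> cancels against the integral quotient
      \<open>t / poly f y\<close>.\<close>
    have "(y * a / t) * (lead_coeff f * (y * y ^ (d - 2)) * (t / poly f y)) \<in> val_ideal w"
      using u yw lead_coeff_in[OF wS] y(4)[OF that]
      by (intro val_ideal_mult val_ring_mult val_ring_power)
    then show ?thesis using t0 u(1) by (simp add: e_def power_d field_simps)
  qed
  ultimately show ?thesis by blast
qed

end

section \<open>Simultaneous approximation of residues\<close>

theorem corollary5p4:
  fixes n :: nat
    and S :: "nat \<Rightarrow> 'k::field sval set"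
    and t :: 'k
    and a :: "nat \<Rightarrow> 'k"
  assumes "t \<noteq> 0"
    and "\<And>i v. i \<in> {1..n} \<Longrightarrow> v \<in> S i \<Longrightarrow> a i \<in> val_ring v"
    and "uniformity_assumption (\<Union>i\<in>{1..n}. S i) t"
    and "\<And>i. i \<in> {1..n} \<Longrightarrow> compactin Zar_star (S i)"
    and "\<And>i j. i \<in> {1..n} \<Longrightarrow> j \<in> {1..n} \<Longrightarrow> i \<noteq> j \<Longrightarrow>
           sets_t_independent t (S i) (S j) \<and> sets_incomparable (S i) (S j)"
  shows "\<exists>x. \<forall>i\<in>{1..n}. \<forall>v\<in>S i. x \<in> val_ring v \<and> residue v x = residue v (a i)"
proof -
  let ?S = "\<Union>i\<in>{1..n}. S i"
  obtain f where "uniform_family ?S t f"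
    using assms(1,3) unfolding uniformity_assumption_def uniform_family_def by blast
  then interpret uniform_family ?S t f .
  have "\<exists>e. (\<forall>v\<in>S i. e - 1 \<in> val_ideal v) \<and>
      (\<forall>j\<in>{1..n} - {i}. \<forall>w\<in>S j. e * a i \<in> val_ideal w)" if i: "i \<in> {1..n}" for i
  proof -
    \<comment> \<open>All other sets are merged into one compact set, so a single indicator serves
      for each \<open>i\<close>.\<close>
    let ?B = "\<Union>j\<in>{1..n} - {i}. S j"
    have "compactin Zar_star ?B" using assms(4) by (intro compactin_Union) auto
    moreover have "sets_t_independent t (S i) ?B" "sets_incomparable (S i) ?B"
      using assms(5)[OF i] by (fastforce simp: sets_t_independent_def sets_incomparable_def)+
    ultimately have "\<exists>e. (\<forall>v\<in>S i. e - 1 \<in> val_ideal v) \<and> (\<forall>w\<in>?B. e * a i \<in> val_ideal w)"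
      using i assms(2)[OF i] assms(4)[OF i] by (intro ex_indicator) auto
    then show ?thesis by auto
  qed
  then obtain e where e: "\<And>i v. i \<in> {1..n} \<Longrightarrow> v \<in> S i \<Longrightarrow> e i - 1 \<in> val_ideal v"
    "\<And>i j w. i \<in> {1..n} \<Longrightarrow> j \<in> {1..n} - {i} \<Longrightarrow> w \<in> S j \<Longrightarrow> e i * a i \<in> val_ideal w"
    by metis
  define x where "x = (\<Sum>i=1..n. e i * a i)"
  have "x \<in> val_ring v \<and> residue v x = residue v (a i)" if iv: "i \<in> {1..n}" "v \<in> S i" for i v
  proof -
    \<comment> \<open>The \<open>i\<close>-th term is compared with \<open>a i\<close>; the
      remaining terms are infinitesimal on \<open>S i\<close>.\<close>
    have "x - a i = (e i - 1) * a i + (\<Sum>j\<in>{1..n} - {i}. e j * a j)"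
      using iv(1) by (simp add: x_def sum.remove[of _ i] algebra_simps)
    also have "\<dots> \<in> val_ideal v"
      using iv by (intro val_ideal_add val_ideal_mult val_ideal_sum e assms(2)) auto
    finally have *: "x - a i \<in> val_ideal v" .
    then have "x - a i + a i \<in> val_ring v"
      using assms(2)[OF iv] by (blast intro: val_ring_add val_ideal_imp_val_ring)
    then show ?thesis using residue_eqI[OF *] by simp
  qed
  then show ?thesis by blast
qed

end
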